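(* Let $q>3$ be a prime power, let $1\le m\le\lfloor n/2\rfloor$, let $a=(a_1,\ldots,a_n)\in\mathbb{F}_q^n$ have pairwise distinct entries and let $v=(v_1,\ldots,v_n)\in(\mathbb{F}_q^* )^n$. Suppose that the generalized Reed-Solomon code $\mathrm{GRS}_m(a,v)$ is Euclidean self-orthogonal, i.e. $\mathrm{GRS}_m(a,v)\subseteq \mathrm{GRS}_m(a,v)^\perp$. Then for all integers $k,l$ with $1\le k\le m$ and $0\le l\le k$, there exists a $q$-ary $[n,k]$ MDS code $C$ with $\dim(\mathrm{Hull}(C))=l$.
   Context: $\mathbb{F}_q$ is the finite field with $q$ elements and $\mathbb{F}_q^*=\mathbb{F}_q\setminus\{0\}$. A $q$-ary $[n,k]$ code is a $k$-dimensional linear subspace of $\mathbb{F}_q^n$; it is MDS (for $k\ge 1$) if its minimum Hamming distance is $n-k+1$. The Euclidean dual of $C\subseteq\mathbb{F}_q^n$ is $C^\perp=\{x\in\mathbb{F}_q^n:\sum_{i=1}^n x_iy_i=0\text{ for all }y\in C\}$, and the (Euclidean) hull is $\mathrm{Hull}(C)=C\cap C^\perp$. For $1\le n\le q$, $a=(a_1,\ldots,a_n)\in\mathbb{F}_q^n$ with distinct entries, $v\in(\mathbb{F}_q^* )^n$ and $1\le k\le n$, $$\mathrm{GRS}_k(a,v)=\{(v_1f(a_1),\ldots,v_nf(a_n)): f\in\mathbb{F}_q[x],\ \deg f\le k-1\}.$$ *)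

theory Defs
  imports "HOL-Analysis.Cartesian_Space" "HOL-Computational_Algebra.Polynomial"
begin

text \<open>
  The field with q elements is a type \<open>'a\<close> of class \<open>{field, finite}\<close> with \<open>q = CARD('a)\<close>
  (automatically a prime power); the ambient space of words of length \<open>n = CARD('n)\<close> is \<open>'a ^ 'n\<close>.
  The constants \<open>vec.subspace\<close> and \<open>vec.dim\<close> are the library's linear algebra over an arbitrary
  scalar field, here \<open>'a\<close>.
\<close>

definition linear_code :: "('a::{field,finite} ^ 'n::finite) set \<Rightarrow> nat \<Rightarrow> bool" where
  "linear_code C k \<longleftrightarrow> vec.subspace C \<and> vec.dim C = k"

definition hamming_dist :: "'a ^ 'n::finite \<Rightarrow> 'a ^ 'n \<Rightarrow> nat" where
  "hamming_dist x y = card {i. x $ i \<noteq> y $ i}"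

text \<open>Only meaningful for codes with at least two words; otherwise \<open>Min\<close> is taken of the empty set.\<close>

definition min_dist :: "('a ^ 'n::finite) set \<Rightarrow> nat" where
  "min_dist C = Min {hamming_dist x y | x y. x \<in> C \<and> y \<in> C \<and> x \<noteq> y}"

text \<open>The subtraction does not truncate, as the dimension \<open>k\<close> is at most \<open>CARD('n)\<close>.\<close>

definition mds_code :: "('a::{field,finite} ^ 'n::finite) set \<Rightarrow> nat \<Rightarrow> bool" where
  "mds_code C k \<longleftrightarrow> 1 \<le> k \<and> linear_code C k \<and> min_dist C = CARD('n) - k + 1"

definition euclidean_dual :: "('a::{field,finite} ^ 'n::finite) set \<Rightarrow> ('a ^ 'n) set" where
  "euclidean_dual C = {x. \<forall>y\<in>C. (\<Sum>i\<in>UNIV. x $ i * y $ i) = 0}"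

definition hull_code :: "('a::{field,finite} ^ 'n::finite) set \<Rightarrow> ('a ^ 'n) set" where
  "hull_code C = C \<inter> euclidean_dual C"

text \<open>
  The condition \<open>f = 0 \<or> degree f < k\<close> is \<open>deg f \<le> k - 1\<close> with the convention that the zero
  polynomial has degree minus infinity (the library puts \<open>degree 0 = 0\<close>).
\<close>

definition GRS :: "nat \<Rightarrow> 'a::{field,finite} ^ 'n::finite \<Rightarrow> 'a ^ 'n \<Rightarrow> ('a ^ 'n) set" where
  "GRS k a v = {\<chi> i. v $ i * poly f (a $ i) | f. f = 0 \<or> degree f < k}"

end

theory Submission
  imports Defs
begin

text \<open>
  Fix \<open>\<alpha> \<noteq> 0\<close> with \<open>\<alpha>\<^sup>2 \<noteq> 1\<close>, which exists as \<open>q > 3\<close>, and multiply \<open>v\<close> by \<open>\<alpha>\<close> on a set \<open>S\<close> of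
  \<open>k - l\<close> coordinates. Since \<open>GRS k a v\<close> is self-orthogonal, the inner product of the words of
  \<open>f\<close> and \<open>g\<close> in the new code is \<open>(\<alpha>\<^sup>2 - 1) (\<Sum>i\<in>S. v\<^sub>i\<^sup>2 f(a\<^sub>i) g(a\<^sub>i))\<close>. Because \<open>card S \<le> k\<close>, testing
  against the \<open>g\<close> that vanish on \<open>S\<close> except at one point shows that the word of \<open>f\<close> lies in the hull
  iff \<open>f\<close> vanishes on \<open>S\<close>, that is, iff \<open>f\<close> is a multiple of \<open>\<Prod>i\<in>S. (x - a\<^sub>i)\<close>; this leaves \<open>l\<close> free
  coefficients.
\<close>

section \<open>Linear structure and dimension of evaluation codes\<close>

lemma GRS_memI: "f = 0 \<or> degree f < k \<Longrightarrow> (\<chi> i. v $ i * poly f (a $ i)) \<in> GRS k a v"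
  by (auto simp: GRS_def)

lemma GRS_memE:
  assumes "x \<in> GRS k a v"
  obtains f where "f = 0 \<or> degree f < k" "x = (\<chi> i. v $ i * poly f (a $ i))"
  using assms by (auto simp: GRS_def)

lemma degree_less_add:
  fixes f g :: "'a::comm_ring_1 poly"
  assumes "f = 0 \<or> degree f < k" "g = 0 \<or> degree g < k"
  shows "f + g = 0 \<or> degree (f + g) < k"
  using assms degree_add_less[of f k g] by auto

lemma GRS_mono: "k \<le> m \<Longrightarrow> GRS k a v \<subseteq> GRS m a v"
  unfolding GRS_def by (blast intro: less_le_trans)

lemma subspace_GRS: "vec.subspace (GRS k a v)"
proof (rule vec.subspaceI)
  show "0 \<in> GRS k a v"
    using GRS_memI[of 0 k v a] by (simp add: vec_eq_iff zero_vec_def)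
next
  fix x y assume "x \<in> GRS k a v" "y \<in> GRS k a v"
  then obtain f g where f: "f = 0 \<or> degree f < k" "x = (\<chi> i. v $ i * poly f (a $ i))"
    and g: "g = 0 \<or> degree g < k" "y = (\<chi> i. v $ i * poly g (a $ i))"
    by (elim GRS_memE)
  have "x + y = (\<chi> i. v $ i * poly (f + g) (a $ i))"
    by (simp add: f g vec_eq_iff algebra_simps)
  then show "x + y \<in> GRS k a v"
    using GRS_memI[OF degree_less_add[OF f(1) g(1)]] by simp
next
  fix c x assume "x \<in> GRS k a v"
  then obtain f where f: "f = 0 \<or> degree f < k" "x = (\<chi> i. v $ i * poly f (a $ i))"
    by (elim GRS_memE)
  have "c *s x = (\<chi> i. v $ i * poly (smult c f) (a $ i))"
    by (simp add: f vec_eq_iff algebra_simps)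
  moreover have "smult c f = 0 \<or> degree (smult c f) < k"
    using f(1) by auto
  ultimately show "c *s x \<in> GRS k a v"
    using GRS_memI by metis
qed

text \<open>The entries of \<open>v\<close> may vanish here; the hull is a code of this degenerate kind.\<close>

lemma dim_GRS:
  fixes a v :: "'a::{field,finite} ^ 'n::finite"
  assumes "\<And>f. degree f < k \<Longrightarrow> (\<And>i. v $ i * poly f (a $ i) = 0) \<Longrightarrow> f = 0"
  shows "vec.dim (GRS k a v) = k"
  using assms
proof (induction k)
  case 0
  have "GRS 0 a v = {0}"
    by (auto simp: GRS_def vec_eq_iff)
  then show ?case by simp
next
  case (Suc k)
  \<comment> \<open>The word of \<open>x^k\<close>, the one new direction gained when the degree
    bound rises from \<open>k\<close> to \<open>Suc k\<close>.\<close>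
  define b where "b = (\<chi> i. v $ i * poly (monom 1 k) (a $ i))"
  have IH: "vec.dim (GRS k a v) = k"
    using Suc.prems by (intro Suc.IH) auto
  have notin: "b \<notin> GRS k a v"
  proof
    assume "b \<in> GRS k a v"
    then obtain f where f: "f = 0 \<or> degree f < k" "b = (\<chi> i. v $ i * poly f (a $ i))"
      by (elim GRS_memE)
    \<comment> \<open>Membership of \<open>b\<close> would give \<open>x^k - f\<close> the zero
      word; injectivity then forces \<open>f = x^k\<close>, whose degree is not below
      \<open>k\<close>.\<close>
    have "degree (monom 1 k - f) < Suc k"
      using f(1) degree_diff_le_max[of "monom 1 k" f] by (auto simp: degree_monom_eq)
    moreover have "v $ i * poly (monom 1 k - f) (a $ i) = 0" for i
      using f(2) by (simp add: b_def vec_eq_iff algebra_simps)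
    ultimately have "monom 1 k - f = 0"
      by (rule Suc.prems)
    then show False
      using f(1) by (auto simp: degree_monom_eq)
  qed
  have "b \<in> GRS (Suc k) a v"
    unfolding b_def by (rule GRS_memI) (simp add: degree_monom_eq)
  then have "insert b (GRS k a v) \<subseteq> GRS (Suc k) a v"
    using GRS_mono[of k "Suc k" a v] by auto
  then have sub1: "vec.span (insert b (GRS k a v)) \<subseteq> GRS (Suc k) a v"
    by (intro vec.span_minimal subspace_GRS)
  have "GRS (Suc k) a v \<subseteq> vec.span (insert b (GRS k a v))"
  proof
    fix x assume "x \<in> GRS (Suc k) a v"
    then obtain f where f: "f = 0 \<or> degree f < Suc k" "x = (\<chi> i. v $ i * poly f (a $ i))"
      by (elim GRS_memE)
    define g where "g = f - monom (coeff f k) k"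
    \<comment> \<open>The case \<open>g = 0\<close> must stay separate: for \<open>k = 0\<close> the
      convention \<open>degree 0 = 0\<close> does not give a degree below \<open>k\<close>.\<close>
    have "degree g < k \<or> g = 0"
    proof (rule disjCI)
      assume "g \<noteq> 0"
      have "degree g \<le> k"
        unfolding g_def using f(1) degree_monom_le[of "coeff f k" k] by (intro degree_diff_le) auto
      moreover have "coeff g k = 0"
        by (simp add: g_def)
      ultimately show "degree g < k"
        using \<open>g \<noteq> 0\<close> by (metis le_neq_implies_less leading_coeff_0_iff)
    qed
    then have "(\<chi> i. v $ i * poly g (a $ i)) \<in> GRS k a v"
      by (intro GRS_memI) auto
    moreover have "x = (\<chi> i. v $ i * poly g (a $ i)) + coeff f k *s b"
      by (simp add: f g_def b_def vec_eq_iff algebra_simps poly_monom)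
    ultimately show "x \<in> vec.span (insert b (GRS k a v))"
      by (auto intro!: vec.span_add vec.span_scale intro: vec.span_base)
  qed
  with sub1 have "vec.span (insert b (GRS k a v)) = GRS (Suc k) a v" by blast
  then have "vec.dim (GRS (Suc k) a v) = vec.dim (insert b (GRS k a v))"
    by (metis vec.dim_span)
  also have "\<dots> = Suc k"
    using notin IH vec.span_eq_iff[THEN iffD2, OF subspace_GRS, of k a v]
    by (simp add: vec.dim_insert del: vec.span_eq_iff)
  finally show ?case .
qed

section \<open>Zeros of polynomials at the evaluation points\<close>

lemma card_zero_coordinates_le:
  fixes a :: "'a::field ^ 'n::finite"
  assumes "inj (\<lambda>i. a $ i)" "f \<noteq> 0"
  shows "card {i. poly f (a $ i) = 0} \<le> degree f"
proof -
  have "card {i. poly f (a $ i) = 0} = card ((\<lambda>i. a $ i) ` {i. poly f (a $ i) = 0})"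
    using assms(1) by (metis card_image inj_on_subset subset_UNIV)
  also have "\<dots> \<le> card {x. poly f x = 0}"
    using poly_roots_finite[OF assms(2)] by (intro card_mono) auto
  also have "\<dots> \<le> degree f"
    using card_poly_roots_bound[OF assms(2)] .
  finally show ?thesis .
qed

lemma poly_eq_0_if_zero_word:
  fixes a v :: "'a::field ^ 'n::finite"
  assumes "inj (\<lambda>i. a $ i)" "\<And>i. v $ i \<noteq> 0" "degree f < CARD('n)"
    and "\<And>i. v $ i * poly f (a $ i) = 0"
  shows "f = 0"
proof (rule ccontr)
  assume "f \<noteq> 0"
  moreover have "{i. poly f (a $ i) = 0} = UNIV"
    using assms(2,4) by auto
  ultimately show False
    using card_zero_coordinates_le[OF assms(1), of f] assms(3) by auto
qed

definition vanishing_poly :: "'a::field ^ 'n::finite \<Rightarrow> 'n set \<Rightarrow> 'a poly" where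
  "vanishing_poly a S = (\<Prod>i\<in>S. [:- (a $ i), 1:])"

lemma vanishing_poly_nonzero: "vanishing_poly a S \<noteq> 0"
  by (simp add: vanishing_poly_def)

lemma degree_vanishing_poly: "degree (vanishing_poly a S) = card S"
  unfolding vanishing_poly_def by (subst degree_prod_eq_sum_degree) auto

lemma poly_vanishing_poly_eq_0_iff:
  assumes "inj (\<lambda>i. a $ i)"
  shows "poly (vanishing_poly a S) (a $ i) = 0 \<longleftrightarrow> i \<in> S"
  using assms by (auto simp: vanishing_poly_def poly_prod inj_def)

text \<open>Linear factors split off one at a time: as the evaluation points are distinct, removing
  the factor at \<open>i\<close> leaves the zeros at the other points in the cofactor.\<close>

lemma vanishing_poly_dvd:
  assumes "inj (\<lambda>i. a $ i)" "\<And>i. i \<in> S \<Longrightarrow> poly f (a $ i) = 0"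
  shows "vanishing_poly a S dvd f"
proof -
  have "finite S" by simp
  then show ?thesis
    using assms(2)
  proof (induction S arbitrary: f)
    case empty
    then show ?case by (simp add: vanishing_poly_def)
  next
    case (insert i S)
    obtain h where h: "f = [:- (a $ i), 1:] * h"
      using insert.prems[of i] by (auto simp: poly_eq_0_iff_dvd elim: dvdE)
    have "poly h (a $ j) = 0" if "j \<in> S" for j
    proof -
      have "a $ j \<noteq> a $ i"
        using that insert.hyps assms(1) by (metis injD)
      then show ?thesis
        using insert.prems[of j] that by (simp add: h)
    qed
    then have "vanishing_poly a S dvd h"
      by (rule insert.IH)
    then show ?case
      using insert.hyps by (simp add: h vanishing_poly_def mult_dvd_mono del: mult_pCons_left)
  qed
qed

section \<open>Minimum distance and the MDS property\<close>

lemma min_dist_GRS: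
  fixes a v :: "'a::{field,finite} ^ 'n::finite"
  assumes "inj (\<lambda>i. a $ i)" "\<And>i. v $ i \<noteq> 0" "1 \<le> k" "k \<le> CARD('n)"
  shows "min_dist (GRS k a v) = CARD('n) - k + 1"
  unfolding min_dist_def
proof (rule Min_eqI)
  have "{hamming_dist x y |x y. x \<in> GRS k a v \<and> y \<in> GRS k a v \<and> x \<noteq> y} \<subseteq> {..CARD('n)}"
    by (auto simp: hamming_dist_def intro: card_mono)
  then show "finite {hamming_dist x y |x y. x \<in> GRS k a v \<and> y \<in> GRS k a v \<and> x \<noteq> y}"
    by (rule finite_subset) simp
next
  fix d assume "d \<in> {hamming_dist x y |x y. x \<in> GRS k a v \<and> y \<in> GRS k a v \<and> x \<noteq> y}"
  then obtain x y where xy: "x \<in> GRS k a v" "y \<in> GRS k a v" "x \<noteq> y" "d = hamming_dist x y"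
    by auto
  have "x - y \<in> GRS k a v"
    using xy by (intro vec.subspace_diff subspace_GRS)
  then obtain f where f: "f = 0 \<or> degree f < k" "x - y = (\<chi> i. v $ i * poly f (a $ i))"
    by (elim GRS_memE)
  have f0: "f \<noteq> 0"
    using f(2) xy(3) by (auto simp: vec_eq_iff)
  have "x $ i \<noteq> y $ i \<longleftrightarrow> poly f (a $ i) \<noteq> 0" for i
  proof -
    have "x $ i - y $ i = v $ i * poly f (a $ i)"
      using f(2) by (metis vec_lambda_beta vector_minus_component)
    then show ?thesis using assms(2)[of i] by (metis eq_iff_diff_eq_0 mult_eq_0_iff)
  qed
  then have "d = card (- {i. poly f (a $ i) = 0})"
    by (simp add: xy(4) hamming_dist_def Collect_neg_eq)
  then have "d = CARD('n) - card {i. poly f (a $ i) = 0}"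
    by (simp add: Compl_eq_Diff_UNIV card_Diff_subset)
  \<comment> \<open>A nonzero \<open>f\<close> of degree at most \<open>k - 1\<close> has at most
    \<open>k - 1\<close> zero coordinates.\<close>
  then show "CARD('n) - k + 1 \<le> d"
    using card_zero_coordinates_le[OF assms(1) f0] f(1) f0 assms(3,4) by auto
next
  \<comment> \<open>The bound is attained by a polynomial vanishing at exactly \<open>k - 1\<close>
    evaluation points.\<close>
  obtain T :: "'n set" where T: "card T = k - 1"
    using obtain_subset_with_card_n[of "k - 1" "UNIV :: 'n set"] assms(4)
    by (metis diff_le_self le_trans)
  define x where "x = (\<chi> i. v $ i * poly (vanishing_poly a T) (a $ i))"
  have "x \<in> GRS k a v"
    unfolding x_def using T assms(3) by (intro GRS_memI) (simp add: degree_vanishing_poly)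
  moreover have "0 \<in> GRS k a v"
    by (rule vec.subspace_0[OF subspace_GRS])
  moreover have "{i. x $ i \<noteq> 0 $ i} = - T"
    using assms(2) poly_vanishing_poly_eq_0_iff[OF assms(1)] by (auto simp: x_def)
  then have d: "hamming_dist x 0 = CARD('n) - k + 1"
    using T assms(3,4) by (simp add: hamming_dist_def Compl_eq_Diff_UNIV card_Diff_subset)
  moreover have "x \<noteq> 0"
    using d by (auto simp: hamming_dist_def)
  ultimately show
    "CARD('n) - k + 1 \<in> {hamming_dist x y |x y. x \<in> GRS k a v \<and> y \<in> GRS k a v \<and> x \<noteq> y}"
    by (smt (verit) mem_Collect_eq)
qed

lemma mds_code_GRS:
  fixes a v :: "'a::{field,finite} ^ 'n::finite"
  assumes "inj (\<lambda>i. a $ i)" "\<And>i. v $ i \<noteq> 0" "1 \<le> k" "k \<le> CARD('n)"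
  shows "mds_code (GRS k a v) k"
proof -
  have "vec.dim (GRS k a v) = k"
    using poly_eq_0_if_zero_word[OF assms(1,2)] assms(4) by (intro dim_GRS) auto
  then show ?thesis
    using min_dist_GRS[OF assms] assms(3) by (simp add: mds_code_def linear_code_def subspace_GRS)
qed

section \<open>The hull after rescaling some coordinates\<close>

lemma hull_GRS_scaled:
  fixes a v :: "'a::{field,finite} ^ 'n::finite"
  assumes inj: "inj (\<lambda>i. a $ i)" and v: "\<And>i. v $ i \<noteq> 0"
    and orth: "GRS k a v \<subseteq> euclidean_dual (GRS k a v)"
    and \<alpha>: "\<alpha> \<noteq> 0" "\<alpha>\<^sup>2 \<noteq> 1"
    and S: "card S \<le> k"
    and w: "\<And>i. w $ i = (if i \<in> S then \<alpha> * v $ i else v $ i)"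
  shows "hull_code (GRS k a w) =
    GRS (k - card S) a (\<chi> i. w $ i * poly (vanishing_poly a S) (a $ i))"
proof -
  define ip where "ip x y = (\<Sum>i\<in>UNIV. x $ i * y $ i)" for x y :: "'a ^ 'n"
  have ip: "ip (\<chi> i. w $ i * poly f (a $ i)) (\<chi> i. w $ i * poly g (a $ i)) =
      (\<alpha>\<^sup>2 - 1) * (\<Sum>i\<in>S. (v $ i)\<^sup>2 * poly f (a $ i) * poly g (a $ i))"
    if f: "f = 0 \<or> degree f < k" and g: "g = 0 \<or> degree g < k" for f g
  proof -
    have "(\<chi> i. v $ i * poly f (a $ i)) \<in> euclidean_dual (GRS k a v)"
      using GRS_memI[OF f] orth by blast
    then have 0: "(\<Sum>i\<in>UNIV. (v $ i * poly f (a $ i)) * (v $ i * poly g (a $ i))) = 0"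
      using GRS_memI[OF g, of v a] by (fastforce simp: euclidean_dual_def)
    \<comment> \<open>On \<open>S\<close> the factor \<open>\<alpha>\<^sup>2\<close> is split as 1 +
      (\<open>\<alpha>\<^sup>2 - 1\<close>); the part with 1 completes the old inner product, which
      is zero.\<close>
    have "ip (\<chi> i. w $ i * poly f (a $ i)) (\<chi> i. w $ i * poly g (a $ i)) =
        (\<Sum>i\<in>UNIV. (v $ i * poly f (a $ i)) * (v $ i * poly g (a $ i)) +
          (if i \<in> S then (\<alpha>\<^sup>2 - 1) * ((v $ i)\<^sup>2 * poly f (a $ i) * poly g (a $ i)) else 0))"
      unfolding ip_def by (intro sum.cong) (auto simp: w algebra_simps power2_eq_square)
    also have "\<dots> = (\<Sum>i\<in>S. (\<alpha>\<^sup>2 - 1) * ((v $ i)\<^sup>2 * poly f (a $ i) * poly g (a $ i)))"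
      by (simp add: sum.distrib 0 sum.If_cases)
    finally show ?thesis by (simp add: sum_distrib_left)
  qed
  show ?thesis
  proof (intro set_eqI iffI)
    fix x assume "x \<in> hull_code (GRS k a w)"
    then have x: "x \<in> GRS k a w" and dual: "\<And>y. y \<in> GRS k a w \<Longrightarrow> ip x y = 0"
      by (auto simp: hull_code_def euclidean_dual_def ip_def)
    from x obtain f where f: "f = 0 \<or> degree f < k" "x = (\<chi> i. w $ i * poly f (a $ i))"
      by (elim GRS_memE)
    have "poly f (a $ j) = 0" if j: "j \<in> S" for j
    proof -
      \<comment> \<open>Among the points of \<open>S\<close> this test polynomial is nonzero only at
        \<open>j\<close>, so the inner product isolates the value of \<open>f\<close> there. Its
        degree is \<open>card S - 1\<close>, hence below \<open>k\<close>.\<close>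
      let ?g = "vanishing_poly a (S - {j})"
      have "card (S - {j}) < card S"
        using j by (intro psubset_card_mono) auto
      then have g: "?g = 0 \<or> degree ?g < k"
        using S by (simp add: degree_vanishing_poly)
      have "0 = ip x (\<chi> i. w $ i * poly ?g (a $ i))"
        using dual GRS_memI[OF g] by metis
      also have "\<dots> = (\<alpha>\<^sup>2 - 1) * (\<Sum>i\<in>S. (v $ i)\<^sup>2 * poly f (a $ i) * poly ?g (a $ i))"
        unfolding f(2) by (rule ip[OF f(1) g])
      also have "(\<Sum>i\<in>S. (v $ i)\<^sup>2 * poly f (a $ i) * poly ?g (a $ i)) =
          (\<Sum>i\<in>{j}. (v $ i)\<^sup>2 * poly f (a $ i) * poly ?g (a $ i))"
        using j poly_vanishing_poly_eq_0_iff[OF inj, of "S - {j}"]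
        by (intro sum.mono_neutral_right) auto
      finally show ?thesis
        using \<alpha>(2) v poly_vanishing_poly_eq_0_iff[OF inj, of "S - {j}" j] by auto
    qed
    then obtain h where h: "f = vanishing_poly a S * h"
      using vanishing_poly_dvd[OF inj] by (metis dvdE)
    \<comment> \<open>Degrees add over a field, so the factor of degree \<open>card S\<close> uses
      up that much of the degree bound on \<open>f\<close>.\<close>
    have "h = 0 \<or> degree h < k - card S"
      using f(1) by (cases "h = 0") (auto simp: h degree_mult_eq vanishing_poly_nonzero degree_vanishing_poly)
    from GRS_memI[OF this, of "\<chi> i. w $ i * poly (vanishing_poly a S) (a $ i)" a]
    show "x \<in> GRS (k - card S) a (\<chi> i. w $ i * poly (vanishing_poly a S) (a $ i))"
      by (simp add: f(2) h mult.assoc)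
  next
    fix x assume "x \<in> GRS (k - card S) a (\<chi> i. w $ i * poly (vanishing_poly a S) (a $ i))"
    then obtain h where h: "h = 0 \<or> degree h < k - card S"
      "x = (\<chi> i. w $ i * poly (vanishing_poly a S * h) (a $ i))"
      by (elim GRS_memE) (simp add: mult.assoc)
    let ?f = "vanishing_poly a S * h"
    have f: "?f = 0 \<or> degree ?f < k"
      using h(1) by (cases "h = 0") (auto simp: degree_mult_eq vanishing_poly_nonzero degree_vanishing_poly)
    have "ip x y = 0" if y: "y \<in> GRS k a w" for y
    proof -
      from y obtain g where g: "g = 0 \<or> degree g < k" "y = (\<chi> i. w $ i * poly g (a $ i))"
        by (elim GRS_memE)
      show ?thesis
        unfolding h(2) g(2) ip[OF f g(1)] using poly_vanishing_poly_eq_0_iff[OF inj, of S]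
        by (simp add: sum.neutral)
    qed
    then show "x \<in> hull_code (GRS k a w)"
      using GRS_memI[OF f, of w a] by (simp add: hull_code_def euclidean_dual_def ip_def h(2))
  qed
qed

text \<open>Only 1 and -1 square to 1, so at most three elements are excluded; in characteristic 2
  these two coincide.\<close>

lemma exists_square_neq_1:
  assumes "CARD('a::{field,finite}) > 3"
  shows "\<exists>\<alpha>::'a. \<alpha> \<noteq> 0 \<and> \<alpha>\<^sup>2 \<noteq> 1"
proof -
  have "card {0, 1, - 1 :: 'a} \<le> 3"
    by (simp add: card_insert_if)
  then have "{0, 1, - 1 :: 'a} \<noteq> UNIV"
    using assms by (metis not_less)
  then show ?thesis
    by (auto simp: power2_eq_1_iff)
qed

theorem theorem1:
  fixes a v :: "'a::{field,finite} ^ 'n::finite"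
    and m :: nat
  assumes "CARD('a) > 3"
    and "1 \<le> m" and "m \<le> CARD('n) div 2"
    and "inj (\<lambda>i. a $ i)"
    and "\<And>i. v $ i \<noteq> 0"
    and "GRS m a v \<subseteq> euclidean_dual (GRS m a v)"
  shows "\<forall>k l :: nat. 1 \<le> k \<and> k \<le> m \<and> l \<le> k \<longrightarrow>
    (\<exists>C :: ('a ^ 'n) set. mds_code C k \<and> vec.dim (hull_code C) = l)"
proof (intro allI impI, elim conjE)
  fix k l :: nat
  assume k: "1 \<le> k" "k \<le> m" and l: "l \<le> k"
  have kn: "k \<le> CARD('n)"
    using k assms(3) by linarith
  obtain \<alpha> :: 'a where \<alpha>: "\<alpha> \<noteq> 0" "\<alpha>\<^sup>2 \<noteq> 1"
    using exists_square_neq_1[OF assms(1)] by blast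
  obtain S :: "'n set" where S: "card S = k - l"
    using obtain_subset_with_card_n[of "k - l" "UNIV :: 'n set"] kn
    by (metis diff_le_self le_trans)
  define w where "w = (\<chi> i. if i \<in> S then \<alpha> * v $ i else v $ i)"
  \<comment> \<open>The multipliers of the hull, seen as a degenerate code; they vanish exactly on
    \<open>S\<close>.\<close>
  define u where "u = (\<chi> i. w $ i * poly (vanishing_poly a S) (a $ i))"
  have w: "w $ i \<noteq> 0" for i
    using \<alpha>(1) assms(5) by (simp add: w_def)
  \<comment> \<open>Self-orthogonality passes from \<open>m\<close> down to \<open>k\<close>: the
    code shrinks while its dual grows.\<close>
  have "GRS k a v \<subseteq> euclidean_dual (GRS k a v)"
    using GRS_mono[OF k(2), of a v] assms(6) unfolding euclidean_dual_def by blast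
  then have "hull_code (GRS k a w) = GRS (k - card S) a u"
    unfolding u_def using S by (intro hull_GRS_scaled[OF assms(4,5) _ \<alpha>]) (auto simp: w_def)
  also have "k - card S = l"
    using S l by simp
  finally have hull: "hull_code (GRS k a w) = GRS l a u" .
  have "vec.dim (GRS l a u) = l"
  proof (rule dim_GRS)
    fix f assume f: "degree f < l" "\<And>i. u $ i * poly f (a $ i) = 0"
    \<comment> \<open>Since \<open>u\<close> may have zero entries, its vanishing factor is moved
      into the polynomial, leaving the nowhere zero \<open>w\<close>. The product has degree below
      \<open>(k - l) + l = k\<close>, so it cannot vanish at all \<open>n\<close> points unless it
      is zero.\<close>
    have "degree (vanishing_poly a S * f) < CARD('n)"
      using degree_mult_le[of "vanishing_poly a S" f] f(1) S l kn
      by (simp add: degree_vanishing_poly)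
    moreover have "w $ i * poly (vanishing_poly a S * f) (a $ i) = 0" for i
      using f(2)[of i] by (simp add: u_def)
    ultimately have "vanishing_poly a S * f = 0"
      by (rule poly_eq_0_if_zero_word[OF assms(4) w])
    then show "f = 0"
      by (simp add: vanishing_poly_nonzero)
  qed
  then show "\<exists>C :: ('a ^ 'n) set. mds_code C k \<and> vec.dim (hull_code C) = l"
    using mds_code_GRS[OF assms(4) w k(1) kn] hull by metis
qed

end
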